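(* Let $P$ be a probability measure on $\mathbb{R}^n$ that is absolutely continuous with respect to the Lebesgue measure, and suppose $c:\mathbb{R}^n\times\mathbb{U}\to\mathbb{R}$ is non-negative, measurable, and bounded. Consider the problem of finding the best quantizer $Q$ with $M$ cells minimizing $$J(P,Q)=\inf_{\gamma}E_P^{Q,\gamma}[c(X,U)],$$ where $Q$ is restricted to $\mathcal{Q}_C(M)$. Then an optimal quantizer exists, i.e. there is $Q^*\in\mathcal{Q}_C(M)$ with $J(P,Q^* )=\inf_{Q\in\mathcal{Q}_C(M)}J(P,Q)$.
   Context: $M\ge1$ is an integer and $\mathbb{U}\subset\mathbb{R}^k$ is a nonempty Borel set. An $M$-cell quantizer is given by a Borel measurable partition $\{B_1,\dots,B_M\}$ of $\mathbb{R}^n$ (some cells $B_i$ may be empty) and is identified with the stochastic kernel $Q$ from $\mathbb{R}^n$ to $\{1,\dots,M\}$ given by $Q(i|x)=1_{\{x\in B_i\}}$. $\mathcal{Q}_C(M)$ is the collection of $M$-cell quantizers all of whose cells are convex subsets of $\mathbb{R}^n$. A policy is a function $\gamma:\{1,\dots,M\}\to\mathbb{U}$, and $$E_P^{Q,\gamma}[c(X,U)]=\sum_{i=1}^M\int_{\mathbb{R}^n}c(x,\gamma(i))\,Q(i|x)P(dx);$$ the infimum in $J(P,Q)$ is over all policies $\gamma$ (it need not be attained). *)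

theory Defs
  imports "HOL-Probability.Probability"
begin

text \<open>
  A quantizer is represented by its indexed family of cells \<open>B 1, \<dots>, B M\<close>. Cells may be empty.
  Indices outside \<open>{1..M}\<close> carry the empty cell, so that quantizers
  correspond one-to-one to such indexed partitions.
\<close>

definition quantizers :: "nat \<Rightarrow> (nat \<Rightarrow> (real ^ 'n) set) set" where
  "quantizers M = {B. (\<forall>i\<in>{1..M}. B i \<in> sets borel) \<and> disjoint_family_on B {1..M} \<and>
     (\<Union>i\<in>{1..M}. B i) = UNIV \<and> (\<forall>i. i \<notin> {1..M} \<longrightarrow> B i = {})}"

definition convex_quantizers :: "nat \<Rightarrow> (nat \<Rightarrow> (real ^ 'n) set) set" where
  "convex_quantizers M = {B \<in> quantizers M. \<forall>i\<in>{1..M}. convex (B i)}"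

definition quantizer_kernel :: "(nat \<Rightarrow> (real ^ 'n) set) \<Rightarrow> nat \<Rightarrow> real ^ 'n \<Rightarrow> real" where
  "quantizer_kernel B i x = indicator (B i) x"

definition policies :: "nat \<Rightarrow> (real ^ 'k) set \<Rightarrow> (nat \<Rightarrow> real ^ 'k) set" where
  "policies M U = ({1..M} \<rightarrow>\<^sub>E U)"

definition expected_cost ::
  "((real ^ 'n) \<times> (real ^ 'k) \<Rightarrow> real) \<Rightarrow> nat \<Rightarrow> (real ^ 'n) measure \<Rightarrow>
    (nat \<Rightarrow> (real ^ 'n) set) \<Rightarrow> (nat \<Rightarrow> real ^ 'k) \<Rightarrow> real" where
  "expected_cost c M P B \<gamma> =
     (\<Sum>i=1..M. \<integral>x. c (x, \<gamma> i) * quantizer_kernel B i x \<partial>P)"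

text \<open>
  The infimum is the real-valued \<open>Inf\<close>. It is the true infimum when \<open>U\<close> is nonempty and
  \<open>c\<close> is nonnegative on \<open>UNIV \<times> U\<close>, since it is then taken over
  a nonempty set bounded below by 0.
\<close>

definition optimal_cost ::
  "((real ^ 'n) \<times> (real ^ 'k) \<Rightarrow> real) \<Rightarrow> (real ^ 'k) set \<Rightarrow> nat \<Rightarrow> (real ^ 'n) measure \<Rightarrow>
    (nat \<Rightarrow> (real ^ 'n) set) \<Rightarrow> real" where
  "optimal_cost c U M P B = (INF \<gamma>\<in>policies M U. expected_cost c M P B \<gamma>)"

end

theory Submission
  imports Defs
begin

text \<open>
  Take convex quantizers whose optimal costs tend to the infimum. Any two cells of a convex
  quantizer are separated by a hyperplane, and a hyperplane is described by a unit vector of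
  \<open>\<real>\<^sup>n \<times> \<real>\<close>, so by compactness of the sphere all the (finitely many) separating hyperplanes
  converge along a subsequence. At a point off the limit hyperplanes, the side on which it lies is
  eventually constant, so the cell that contains it is eventually constant too. Hence, outside a
  Lebesgue null set, the cells converge pointwise to open convex polyhedra
  (\<open>stabilisation_off_limit_hyperplanes\<close>).

  These polyhedra need not cover the limit hyperplanes. To obtain a genuine partition into convex
  sets, fix a vector \<open>v\<close> transversal to all the limit hyperplanes, and put \<open>x\<close> into the cell that
  contains \<open>x + \<epsilon>v\<close> for all small \<open>\<epsilon> > 0\<close>. This amounts to choosing, for each limit half-space,
  whether it is open or closed, so the new cells are convex
  (\<open>convex_quantizers_subsequence_limit\<close>).

  Since \<open>P\<close> is absolutely continuous, the indicators of the cells converge in \<open>L\<^sup>1(P)\<close>; since \<open>c\<close> is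
  bounded, the expected costs converge uniformly over all policies, and therefore so do the
  optimal costs (\<open>optimal_cost_tendsto\<close>). The limit quantizer attains the infimum.
\<close>

section \<open>Separation by normalised affine functionals\<close>

text \<open>
  A pair \<open>z = (a, s)\<close> stands for the affine functional \<open>x \<mapsto> a \<bullet> x + s = z \<bullet> (x, 1)\<close>. Pairs with
  \<open>a = 0\<close> are included: they separate when one of the two sets is empty, and they can also arise as
  limits of hyperplanes that move off to infinity. Normalising the whole pair, rather than \<open>a\<close>
  alone, is what makes the family of functionals compact.
\<close>

lemma separating_unit_functional:
  fixes S T :: "'a::euclidean_space set"
  assumes "convex S" "convex T" "S \<inter> T = {}"
  obtains z :: "'a \<times> real" where "norm z = 1"
    "\<And>x. x \<in> S \<Longrightarrow> z \<bullet> (x, 1) \<le> 0" "\<And>x. x \<in> T \<Longrightarrow> 0 \<le> z \<bullet> (x, 1)"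
proof (cases "S = {} \<or> T = {}")
  case True
  then show ?thesis
  proof
    assume "S = {}"
    then show ?thesis by (intro that[of "(0, 1)"]) (auto simp: norm_Pair)
  next
    assume "T = {}"
    then show ?thesis by (intro that[of "(0, -1)"]) (auto simp: norm_Pair)
  qed
next
  case False
  then obtain a b where ab: "a \<noteq> 0" "\<forall>x\<in>S. a \<bullet> x \<le> b" "\<forall>x\<in>T. b \<le> a \<bullet> x"
    using separating_hyperplane_sets[of S T] assms by auto
  define w where "w = (a, -b)"
  have w: "w \<noteq> 0" using ab by (simp add: w_def zero_prod_def)
  show ?thesis
  proof (rule that[of "w /\<^sub>R norm w"])
    show "norm (w /\<^sub>R norm w) = 1" using w by simp
    show "(w /\<^sub>R norm w) \<bullet> (x, 1) \<le> 0" if "x \<in> S" for x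
    proof -
      have "w \<bullet> (x, 1) \<le> 0" using ab that by (auto simp: w_def)
      then show ?thesis by (simp add: mult_nonneg_nonpos)
    qed
    show "0 \<le> (w /\<^sub>R norm w) \<bullet> (x, 1)" if "x \<in> T" for x
    proof -
      have "0 \<le> w \<bullet> (x, 1)" using ab that by (auto simp: w_def)
      then show ?thesis by simp
    qed
  qed
qed

lemma AE_affine_functional_nonzero:
  fixes z :: "'a::euclidean_space \<times> real"
  assumes "z \<noteq> 0"
  shows "AE x in lborel. z \<bullet> (x, 1) \<noteq> 0"
proof -
  have eq: "{x. z \<bullet> (x, 1) = 0} = {x. fst z \<bullet> x = - snd z}"
    by (auto simp: inner_prod_def algebra_simps)
  have "negligible {x. z \<bullet> (x, 1) = 0}"
    unfolding eq using assms by (intro negligible_hyperplane) (auto simp: prod_eq_iff)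
  moreover have "closed {x. z \<bullet> (x, 1) = 0}"
    unfolding eq by (rule closed_hyperplane)
  ultimately have "{x. z \<bullet> (x, 1) = 0} \<in> null_sets lborel"
    using negligible_iff_null_sets null_sets_completion_iff[of _ lborel] by force
  then show ?thesis
    by (rule AE_I') auto
qed

text \<open>The subspaces to be avoided have measure zero, so finitely many of them do not cover the space.\<close>

lemma transversal_vector_exists:
  fixes A :: "'a::euclidean_space set"
  assumes "finite A" "0 \<notin> A"
  obtains v where "\<And>a. a \<in> A \<Longrightarrow> a \<bullet> v \<noteq> 0"
proof -
  have "negligible (\<Union>a\<in>A. {v. a \<bullet> v = 0})"
    using assms by (intro negligible_Union) (auto intro!: negligible_hyperplane)
  then have "(\<Union>a\<in>A. {v. a \<bullet> v = 0}) \<noteq> UNIV"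
    using non_negligible_UNIV by metis
  then show ?thesis using that by auto
qed

text \<open>
  Along \<open>x + \<epsilon>v\<close> the functional \<open>z\<close> is affine in \<open>\<epsilon>\<close>, and not identically zero when \<open>z \<noteq> 0\<close> and \<open>v\<close>
  is transversal to \<open>z\<close>. So for small \<open>\<epsilon> > 0\<close> its sign is that of its value at \<open>x\<close>, or that of its
  slope when \<open>x\<close> lies on the hyperplane.
\<close>

lemma eventually_perturbed_sign:
  fixes z :: "'a::euclidean_space \<times> real"
  assumes "z \<noteq> 0" and v: "fst z \<noteq> 0 \<Longrightarrow> fst z \<bullet> v \<noteq> 0"
  shows "\<forall>\<^sub>F e in at_right 0. z \<bullet> (x + e *\<^sub>R v, 1) \<noteq> 0 \<and>
    (z \<bullet> (x + e *\<^sub>R v, 1) < 0 \<longleftrightarrow> (if fst z \<bullet> v < 0 then z \<bullet> (x, 1) \<le> 0 else z \<bullet> (x, 1) < 0))"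
proof -
  define s d where "s = z \<bullet> (x, 1)" and "d = fst z \<bullet> v"
  have eq: "z \<bullet> (x + e *\<^sub>R v, 1) = s + e * d" for e
    by (simp add: s_def d_def inner_prod_def algebra_simps)
  have lim: "((\<lambda>e. s + e * d) \<longlongrightarrow> s + 0 * d) (at_right 0)"
    by (intro tendsto_intros)
  have "\<forall>\<^sub>F e in at_right 0. s + e * d \<noteq> 0 \<and>
      (s + e * d < 0 \<longleftrightarrow> (if d < 0 then s \<le> 0 else s < 0))"
  proof (cases s "0::real" rule: linorder_cases)
    case less
    have "\<forall>\<^sub>F e in at_right 0. s + e * d < 0"
      using order_tendstoD(2)[OF lim] less by simp
    then show ?thesis by eventually_elim (use less in auto)
  next
    case greater
    have "\<forall>\<^sub>F e in at_right 0. 0 < s + e * d"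
      using order_tendstoD(1)[OF lim] greater by simp
    then show ?thesis by eventually_elim (use greater in auto)
  next
    case equal
    have "d \<noteq> 0"
    proof
      assume "d = 0"
      then have "fst z = 0" using v d_def by auto
      then show False using equal \<open>z \<noteq> 0\<close> by (auto simp: s_def inner_prod_def prod_eq_iff)
    qed
    have "\<forall>\<^sub>F e in at_right (0::real). 0 < e"
      by (simp add: eventually_at_right_less)
    then show ?thesis
      by eventually_elim
        (use equal \<open>d \<noteq> 0\<close> in \<open>auto simp: mult_less_0_iff\<close>)
  qed
  then show ?thesis
    unfolding eq s_def[symmetric] d_def[symmetric] .
qed

section \<open>Limits of convex partitions\<close>

lemma sphere_family_convergent_subsequence:
  fixes w :: "nat \<Rightarrow> 'i::countable \<Rightarrow> 'b::euclidean_space"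
  assumes "\<And>n p. norm (w n p) = 1"
  obtains r z where "strict_mono (r :: nat \<Rightarrow> nat)" "\<And>p. norm (z p) = 1"
    "\<And>p. (\<lambda>n. w (r n) p) \<longlonglongrightarrow> z p"
proof -
  let ?K = "PiE UNIV (\<lambda>_. sphere (0::'b) 1) :: ('i \<Rightarrow> 'b) set"
  have "compactin (product_topology (\<lambda>_. euclidean) UNIV) ?K"
    unfolding compactin_PiE by simp
  then have "compact ?K"
    by (simp add: euclidean_product_topology)
  then have "seq_compact ?K"
    by (rule compact_imp_seq_compact)
  moreover have "\<forall>n. w n \<in> ?K"
    using assms by auto
  ultimately obtain z r where z: "z \<in> ?K" and r: "strict_mono (r :: nat \<Rightarrow> nat)"
    and lim: "(w \<circ> r) \<longlonglongrightarrow> z"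
    by (rule seq_compactE)
  show ?thesis
  proof (rule that[OF r])
    show "norm (z p) = 1" for p using z by (auto simp: PiE_iff)
    have "continuous_on UNIV (\<lambda>f :: 'i \<Rightarrow> 'b. f p)" for p
      by (rule continuous_on_product_coordinates)
    then have "isCont (\<lambda>f :: 'i \<Rightarrow> 'b. f p) z" for p
      using continuous_on_eq_continuous_at[OF open_UNIV] by blast
    from isCont_tendsto_compose[OF this lim]
    show "(\<lambda>n. w (r n) p) \<longlonglongrightarrow> z p" for p
      by (simp add: o_def)
  qed
qed

text \<open>
  Let \<open>w n (i, j)\<close> separate the cells \<open>i\<close> and \<open>j\<close> of the \<open>n\<close>-th partition. If \<open>y\<close> is off all limit
  hyperplanes, then for large \<open>n\<close> it is also off the separating hyperplanes, on the same sides. In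
  a partition, being strictly on the \<open>i\<close>-side of every hyperplane \<open>(i, j)\<close> excludes every cell but
  the \<open>i\<close>-th, so then the signs at \<open>y\<close> determine its cell.
\<close>

lemma stabilisation_off_limit_hyperplanes:
  fixes Q :: "nat \<Rightarrow> nat \<Rightarrow> 'a::euclidean_space set" and y :: 'a
  assumes "finite I"
    and disj: "\<And>n. disjoint_family_on (Q n) I" and cover: "\<And>n. (\<Union>i\<in>I. Q n i) = UNIV"
    and sepL: "\<And>n i j x. i \<in> I \<Longrightarrow> j \<in> I - {i} \<Longrightarrow> x \<in> Q n i \<Longrightarrow> w n (i, j) \<bullet> (x, 1) \<le> 0"
    and sepR: "\<And>n i j x. i \<in> I \<Longrightarrow> j \<in> I - {i} \<Longrightarrow> x \<in> Q n j \<Longrightarrow> 0 \<le> w n (i, j) \<bullet> (x, 1)"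
    and lim: "\<And>p. (\<lambda>n. w n p) \<longlonglongrightarrow> z p"
    and off: "\<And>i j. i \<in> I \<Longrightarrow> j \<in> I - {i} \<Longrightarrow> z (i, j) \<bullet> (y, 1) \<noteq> 0"
  shows "\<forall>\<^sub>F n in sequentially. \<forall>i\<in>I. y \<in> Q n i \<longleftrightarrow> (\<forall>j\<in>I - {i}. z (i, j) \<bullet> (y, 1) < 0)"
    and "\<exists>!i. i \<in> I \<and> (\<forall>j\<in>I - {i}. z (i, j) \<bullet> (y, 1) < 0)"
proof -
  have sign: "\<forall>\<^sub>F n in sequentially. w n (i, j) \<bullet> (y, 1) \<noteq> 0 \<and>
      (w n (i, j) \<bullet> (y, 1) < 0 \<longleftrightarrow> z (i, j) \<bullet> (y, 1) < 0)" if "i \<in> I" "j \<in> I - {i}" for i j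
  proof -
    have l: "(\<lambda>n. w n (i, j) \<bullet> (y, 1)) \<longlonglongrightarrow> z (i, j) \<bullet> (y, 1)"
      by (intro tendsto_intros lim)
    show ?thesis
    proof (cases "z (i, j) \<bullet> (y, 1) < 0")
      case True
      from order_tendstoD(2)[OF l this] show ?thesis
        by eventually_elim (use True in auto)
    next
      case False
      then have "0 < z (i, j) \<bullet> (y, 1)" using off[OF that] by auto
      from order_tendstoD(1)[OF l this] show ?thesis
        by eventually_elim (use False in auto)
    qed
  qed
  have "\<forall>\<^sub>F n in sequentially. \<forall>i\<in>I. \<forall>j\<in>I - {i}. w n (i, j) \<bullet> (y, 1) \<noteq> 0 \<and>
      (w n (i, j) \<bullet> (y, 1) < 0 \<longleftrightarrow> z (i, j) \<bullet> (y, 1) < 0)"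
    using \<open>finite I\<close> sign by (intro eventually_ball_finite ballI) auto
  then show ev: "\<forall>\<^sub>F n in sequentially. \<forall>i\<in>I. y \<in> Q n i \<longleftrightarrow>
      (\<forall>j\<in>I - {i}. z (i, j) \<bullet> (y, 1) < 0)"
  proof eventually_elim
    case (elim n)
    show ?case
    proof (intro ballI iffI)
      fix i j assume "i \<in> I" "y \<in> Q n i" "j \<in> I - {i}"
      then show "z (i, j) \<bullet> (y, 1) < 0"
        using sepL[of i j y n] elim by force
    next
      fix i assume i: "i \<in> I" and neg: "\<forall>j\<in>I - {i}. z (i, j) \<bullet> (y, 1) < 0"
      obtain k where k: "k \<in> I" "y \<in> Q n k" using cover[of n] by blast
      have "k = i"
      proof (rule ccontr)
        assume "k \<noteq> i"
        then have "0 \<le> w n (i, k) \<bullet> (y, 1)" "z (i, k) \<bullet> (y, 1) < 0"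
          using sepR[of i k y n] i k neg by auto
        then show False using elim i k \<open>k \<noteq> i\<close> by force
      qed
      then show "y \<in> Q n i" using k by simp
    qed
  qed
  obtain n where n: "\<forall>i\<in>I. y \<in> Q n i \<longleftrightarrow> (\<forall>j\<in>I - {i}. z (i, j) \<bullet> (y, 1) < 0)"
    using eventually_happens[OF ev] by auto
  have "\<exists>!i. i \<in> I \<and> y \<in> Q n i"
  proof (rule ex_ex1I)
    show "\<exists>i. i \<in> I \<and> y \<in> Q n i" using cover[of n] by blast
    show "\<And>i k. i \<in> I \<and> y \<in> Q n i \<Longrightarrow> k \<in> I \<and> y \<in> Q n k \<Longrightarrow> i = k"
      using disj[of n] unfolding disjoint_family_on_def by blast
  qed
  then show "\<exists>!i. i \<in> I \<and> (\<forall>j\<in>I - {i}. z (i, j) \<bullet> (y, 1) < 0)"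
    using n by (metis (no_types, lifting))
qed

text \<open>
  The limit quantizer is built cell by cell from half-spaces, closed or open according to the slope
  of the limit functional along the transversal vector \<open>v\<close>. A point \<open>x\<close> lies in the same cells as
  \<open>x + \<epsilon>v\<close> does for small \<open>\<epsilon> > 0\<close>, and \<open>x + \<epsilon>v\<close> avoids all limit hyperplanes, so it lies in
  exactly one.
\<close>

lemma convex_quantizers_subsequence_limit:
  fixes Q :: "nat \<Rightarrow> nat \<Rightarrow> (real ^ 'n) set"
  assumes Q: "\<And>n. Q n \<in> convex_quantizers M"
  obtains r B where "strict_mono (r :: nat \<Rightarrow> nat)" "B \<in> convex_quantizers M"
    "AE x in lborel. \<forall>\<^sub>F n in sequentially. \<forall>i\<in>{1..M}. x \<in> Q (r n) i \<longleftrightarrow> x \<in> B i"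
proof -
  let ?I = "{1..M}"
  have disj: "disjoint_family_on (Q n) ?I" and cover: "(\<Union>i\<in>?I. Q n i) = UNIV" for n
    using Q[of n] by (auto simp: convex_quantizers_def quantizers_def)
  have conv: "convex (Q n i)" if "i \<in> ?I" for n i
    using Q[of n] that by (auto simp: convex_quantizers_def)
  \<comment> \<open>Pairs of indices that need no separation get a dummy unit vector, so that the whole family,
    indexed by the countable type of pairs, lies in a power of the sphere.\<close>
  have separator: "\<exists>w :: (real ^ 'n) \<times> real. norm w = 1 \<and> (fst p \<in> ?I \<longrightarrow> snd p \<in> ?I - {fst p} \<longrightarrow>
      (\<forall>x\<in>Q n (fst p). w \<bullet> (x, 1) \<le> 0) \<and> (\<forall>x\<in>Q n (snd p). 0 \<le> w \<bullet> (x, 1)))" for n p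
  proof (cases "fst p \<in> ?I \<and> snd p \<in> ?I - {fst p}")
    case True
    then have "Q n (fst p) \<inter> Q n (snd p) = {}"
      using disj[of n] unfolding disjoint_family_on_def by blast
    with True conv obtain w :: "(real ^ 'n) \<times> real" where "norm w = 1"
      "\<And>x. x \<in> Q n (fst p) \<Longrightarrow> w \<bullet> (x, 1) \<le> 0" "\<And>x. x \<in> Q n (snd p) \<Longrightarrow> 0 \<le> w \<bullet> (x, 1)"
      using separating_unit_functional[of "Q n (fst p)" "Q n (snd p)"] by blast
    then show ?thesis by blast
  next
    case False
    then show ?thesis
      by (intro exI[of _ "(0, 1)"]) (auto simp: norm_Pair)
  qed
  have "\<exists>w :: nat \<Rightarrow> nat \<times> nat \<Rightarrow> (real ^ 'n) \<times> real. \<forall>n p.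
      norm (w n p) = 1 \<and> (fst p \<in> ?I \<longrightarrow> snd p \<in> ?I - {fst p} \<longrightarrow>
      (\<forall>x\<in>Q n (fst p). w n p \<bullet> (x, 1) \<le> 0) \<and> (\<forall>x\<in>Q n (snd p). 0 \<le> w n p \<bullet> (x, 1)))"
    by (intro choice allI) (rule separator)
  then obtain w :: "nat \<Rightarrow> nat \<times> nat \<Rightarrow> (real ^ 'n) \<times> real"
    where w1: "\<And>n p. norm (w n p) = 1"
    and w: "\<And>n p. fst p \<in> ?I \<longrightarrow> snd p \<in> ?I - {fst p} \<longrightarrow>
      (\<forall>x\<in>Q n (fst p). w n p \<bullet> (x, 1) \<le> 0) \<and> (\<forall>x\<in>Q n (snd p). 0 \<le> w n p \<bullet> (x, 1))"
    by blast
  obtain r z where r: "strict_mono (r :: nat \<Rightarrow> nat)" and z1: "\<And>p. norm (z p) = 1"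
    and lim: "\<And>p. (\<lambda>n. w (r n) p) \<longlonglongrightarrow> z p"
    using sphere_family_convergent_subsequence[of w] w1 by blast
  have z0: "z p \<noteq> 0" for p using z1[of p] by auto
  have wL: "w (r n) (i, j) \<bullet> (x, 1) \<le> 0"
    if "i \<in> ?I" "j \<in> ?I - {i}" "x \<in> Q (r n) i" for n i j x
    using w[of "(i, j)" "r n"] that by auto
  have wR: "0 \<le> w (r n) (i, j) \<bullet> (x, 1)"
    if "i \<in> ?I" "j \<in> ?I - {i}" "x \<in> Q (r n) j" for n i j x
    using w[of "(i, j)" "r n"] that by auto
  note stab = stabilisation_off_limit_hyperplanes[of ?I "\<lambda>n. Q (r n)" "\<lambda>n. w (r n)" z,
      OF finite_atLeastAtMost disj cover wL wR lim]

  \<comment> \<open>A functional with zero linear part has no hyperplane to cross, hence is left out here.\<close>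
  obtain v where v: "\<And>a. a \<in> (\<lambda>p. fst (z p)) ` (?I \<times> ?I) - {0} \<Longrightarrow> a \<bullet> v \<noteq> 0"
    using transversal_vector_exists[of "(\<lambda>p. fst (z p)) ` (?I \<times> ?I) - {0}"] by auto
  define H where "H p = (if fst (z p) \<bullet> v < 0 then {x. z p \<bullet> (x, 1) \<le> 0}
    else {x. z p \<bullet> (x, 1) < 0})" for p
  define B where "B i = (if i \<in> ?I then \<Inter>j\<in>?I - {i}. H (i, j) else {})" for i
  have H_eq: "H p = (if fst (z p) \<bullet> v < 0 then {x. fst (z p) \<bullet> x \<le> - snd (z p)}
    else {x. fst (z p) \<bullet> x < - snd (z p)})" for p
    unfolding H_def by (auto simp: inner_prod_def)
  have "convex (H p)" for p
    unfolding H_eq by (simp add: convex_halfspace_le convex_halfspace_lt)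
  then have B_conv: "convex (B i)" for i
    unfolding B_def by (auto intro!: convex_INT)
  have "H p \<in> sets borel" for p
    unfolding H_eq
    by (auto intro!: borel_open borel_closed open_halfspace_lt closed_halfspace_le)
  then have "(\<Inter>j\<in>?I - {i}. H (i, j)) \<in> sets borel" for i
  proof (cases "?I - {i} = {}")
    case True
    show ?thesis unfolding True by simp
  qed (intro sets.finite_INT, auto)
  then have B_borel: "B i \<in> sets borel" for i
    by (simp add: B_def)

  have in_H: "x \<in> H p \<longleftrightarrow> (if fst (z p) \<bullet> v < 0 then z p \<bullet> (x, 1) \<le> 0 else z p \<bullet> (x, 1) < 0)"
    for x p by (simp add: H_def)
  have in_B: "x \<in> B i \<longleftrightarrow> (\<forall>j\<in>?I - {i}. x \<in> H (i, j))" if "i \<in> ?I" for x i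
    using that by (simp add: B_def)
  have unique_cell: "\<exists>!i. i \<in> ?I \<and> x \<in> B i" for x
  proof -
    have "\<forall>\<^sub>F e in at_right 0. \<forall>p\<in>?I \<times> ?I. z p \<bullet> (x + e *\<^sub>R v, 1) \<noteq> 0 \<and>
        (z p \<bullet> (x + e *\<^sub>R v, 1) < 0 \<longleftrightarrow> x \<in> H p)"
    proof (intro eventually_ball_finite ballI)
      fix p assume p: "p \<in> ?I \<times> ?I"
      show "\<forall>\<^sub>F e in at_right 0. z p \<bullet> (x + e *\<^sub>R v, 1) \<noteq> 0 \<and>
          (z p \<bullet> (x + e *\<^sub>R v, 1) < 0 \<longleftrightarrow> x \<in> H p)"
        unfolding in_H
      proof (rule eventually_perturbed_sign[OF z0])
        assume "fst (z p) \<noteq> 0"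
        with p show "fst (z p) \<bullet> v \<noteq> 0" by (intro v) blast
      qed
    qed auto
    from eventually_happens[OF this] obtain e where e: "\<And>p. p \<in> ?I \<times> ?I \<Longrightarrow> z p \<bullet> (x + e *\<^sub>R v, 1) \<noteq> 0 \<and>
        (z p \<bullet> (x + e *\<^sub>R v, 1) < 0 \<longleftrightarrow> x \<in> H p)"
      by (metis trivial_limit_at_right_real)
    have "\<exists>!i. i \<in> ?I \<and> (\<forall>j\<in>?I - {i}. z (i, j) \<bullet> (x + e *\<^sub>R v, 1) < 0)"
      by (rule stab(2)) (use e in auto)
    moreover have "(\<forall>j\<in>?I - {i}. z (i, j) \<bullet> (x + e *\<^sub>R v, 1) < 0) \<longleftrightarrow> x \<in> B i"
      if "i \<in> ?I" for i
      using e that in_B by auto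
    ultimately show ?thesis by (metis (no_types, lifting))
  qed
  have "B \<in> convex_quantizers M"
    unfolding convex_quantizers_def quantizers_def
  proof (intro CollectI conjI ballI allI impI)
    show "disjoint_family_on B ?I"
      using unique_cell unfolding disjoint_family_on_def by blast
    show "(\<Union>i\<in>?I. B i) = UNIV"
      using unique_cell by blast
    show "B i = {}" if "i \<notin> ?I" for i
      using that by (simp only: B_def if_False)
  qed (rule B_borel B_conv)+
  moreover have "AE x in lborel. \<forall>\<^sub>F n in sequentially. \<forall>i\<in>?I. x \<in> Q (r n) i \<longleftrightarrow> x \<in> B i"
  proof -
    have "AE x in lborel. \<forall>p\<in>?I \<times> ?I. z p \<bullet> (x, 1) \<noteq> 0"
      using AE_affine_functional_nonzero[OF z0] by (intro AE_finite_allI) auto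
    then show ?thesis
    proof eventually_elim
      case (elim x)
      have "\<forall>\<^sub>F n in sequentially. \<forall>i\<in>?I. x \<in> Q (r n) i \<longleftrightarrow>
          (\<forall>j\<in>?I - {i}. z (i, j) \<bullet> (x, 1) < 0)"
        by (rule stab(1)) (use elim in auto)
      moreover have "x \<in> B i \<longleftrightarrow> (\<forall>j\<in>?I - {i}. z (i, j) \<bullet> (x, 1) < 0)" if "i \<in> ?I" for i
        using elim that by (force simp: in_B H_def order_less_le)
      ultimately show ?case
        by (elim eventually_mono) blast
    qed
  qed
  ultimately show ?thesis using r that by blast
qed

section \<open>Continuity of the optimal cost\<close>

text \<open>
  The bound does not involve the policy, which is why convergence of the cells carries over to
  the infimum over policies.
\<close>

lemma expected_cost_diff_le:
  fixes P :: "(real ^ 'n) measure" and c :: "(real ^ 'n) \<times> (real ^ 'k) \<Rightarrow> real"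
  assumes "prob_space P" and sets_P: "sets P = sets borel"
    and meas: "c \<in> borel_measurable (restrict_space borel (UNIV \<times> U))"
    and bound: "\<And>x u. u \<in> U \<Longrightarrow> \<bar>c (x, u)\<bar> \<le> K"
    and B: "B \<in> quantizers M" "B' \<in> quantizers M" and \<gamma>: "\<gamma> \<in> policies M U"
  shows "\<bar>expected_cost c M P B \<gamma> - expected_cost c M P B' \<gamma>\<bar>
    \<le> (\<Sum>i=1..M. K * (\<integral>x. \<bar>indicator (B i) x - indicator (B' i) x\<bar> \<partial>P))"
proof -
  interpret prob_space P by fact
  have cell: "\<bar>(\<integral>x. c (x, \<gamma> i) * indicator (B i) x \<partial>P) - (\<integral>x. c (x, \<gamma> i) * indicator (B' i) x \<partial>P)\<bar>
      \<le> K * (\<integral>x. \<bar>indicator (B i) x - indicator (B' i) x\<bar> \<partial>P)" if i: "i \<in> {1..M}" for i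
  proof -
    have u: "\<gamma> i \<in> U" using \<gamma> i by (auto simp: policies_def)
    have K: "0 \<le> K" using bound[OF u, of 0] by linarith
    have [measurable]: "B i \<in> sets P" "B' i \<in> sets P"
      using B i sets_P by (auto simp: quantizers_def)
    have "(\<lambda>x :: real ^ 'n. (x, \<gamma> i)) \<in> measurable borel (restrict_space borel (UNIV \<times> U))"
      using u by (intro measurable_restrict_space2 borel_measurable_Pair) auto
    from measurable_compose[OF this meas] have [measurable]: "(\<lambda>x. c (x, \<gamma> i)) \<in> borel_measurable P"
      using measurable_cong_sets[OF sets_P refl] by auto
    have int: "integrable P (\<lambda>x. c (x, \<gamma> i) * indicator S x)" if [measurable]: "S \<in> sets P" for S
      by (rule integrable_const_bound[of _ K])
        (use bound[OF u] K in \<open>auto simp: indicator_def\<close>)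
    have intd: "integrable P (\<lambda>x. \<bar>indicator (B i) x - indicator (B' i) x\<bar> :: real)"
      by (rule integrable_const_bound[of _ 1]) (auto simp: indicator_def)
    have "\<bar>(\<integral>x. c (x, \<gamma> i) * indicator (B i) x \<partial>P) - (\<integral>x. c (x, \<gamma> i) * indicator (B' i) x \<partial>P)\<bar>
        = \<bar>\<integral>x. c (x, \<gamma> i) * indicator (B i) x - c (x, \<gamma> i) * indicator (B' i) x \<partial>P\<bar>"
      using int by simp
    also have "\<dots> \<le> (\<integral>x. \<bar>c (x, \<gamma> i) * indicator (B i) x - c (x, \<gamma> i) * indicator (B' i) x\<bar> \<partial>P)"
      by (rule integral_abs_bound)
    also have "\<dots> \<le> (\<integral>x. K * \<bar>indicator (B i) x - indicator (B' i) x\<bar> \<partial>P)"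
    proof (rule integral_mono)
      fix x
      show "\<bar>c (x, \<gamma> i) * indicator (B i) x - c (x, \<gamma> i) * indicator (B' i) x\<bar>
          \<le> K * \<bar>indicator (B i) x - indicator (B' i) x\<bar>"
        using bound[OF u, of x] K by (auto simp: indicator_def)
    qed (use int intd in auto)
    also have "\<dots> = K * (\<integral>x. \<bar>indicator (B i) x - indicator (B' i) x\<bar> \<partial>P)"
      using intd by simp
    finally show ?thesis .
  qed
  show ?thesis
    unfolding expected_cost_def quantizer_kernel_def sum_subtractf[symmetric]
    by (rule order_trans[OF sum_abs sum_mono]) (rule cell)
qed

lemma abs_cINF_diff_le:
  fixes f g :: "'a \<Rightarrow> real"
  assumes "A \<noteq> {}" "bdd_below (f ` A)" "bdd_below (g ` A)"
    and d: "\<And>a. a \<in> A \<Longrightarrow> \<bar>f a - g a\<bar> \<le> d"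
  shows "\<bar>(INF a\<in>A. f a) - (INF a\<in>A. g a)\<bar> \<le> d"
proof -
  have "(INF a\<in>A. f a) - d \<le> (INF a\<in>A. g a)"
  proof (rule cINF_greatest[OF \<open>A \<noteq> {}\<close>])
    fix a assume "a \<in> A"
    then show "(INF a\<in>A. f a) - d \<le> g a"
      using cINF_lower[OF assms(2), of a] d[of a] by linarith
  qed
  moreover have "(INF a\<in>A. g a) - d \<le> (INF a\<in>A. f a)"
  proof (rule cINF_greatest[OF \<open>A \<noteq> {}\<close>])
    fix a assume "a \<in> A"
    then show "(INF a\<in>A. g a) - d \<le> f a"
      using cINF_lower[OF assms(3), of a] d[of a] by linarith
  qed
  ultimately show ?thesis by linarith
qed

lemma expected_cost_nonneg:
  assumes "\<And>x u. u \<in> U \<Longrightarrow> 0 \<le> c (x, u)" "\<gamma> \<in> policies M U"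
  shows "0 \<le> expected_cost c M P B \<gamma>"
  unfolding expected_cost_def quantizer_kernel_def
  using assms by (intro sum_nonneg integral_nonneg_AE) (auto simp: policies_def PiE_iff)

lemma policies_nonempty: "U \<noteq> {} \<Longrightarrow> policies M U \<noteq> {}"
  by (auto simp: policies_def PiE_eq_empty_iff)

lemma optimal_cost_tendsto:
  fixes P :: "(real ^ 'n) measure" and c :: "(real ^ 'n) \<times> (real ^ 'k) \<Rightarrow> real"
  assumes P: "prob_space P" and sets_P: "sets P = sets borel" and "U \<noteq> {}"
    and meas: "c \<in> borel_measurable (restrict_space borel (UNIV \<times> U))"
    and nonneg: "\<And>x u. u \<in> U \<Longrightarrow> 0 \<le> c (x, u)"
    and bdd: "bounded (c ` (UNIV \<times> U))"
    and Q: "\<And>n. Q n \<in> quantizers M" and B: "B \<in> quantizers M"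
    and lim: "AE x in P. \<forall>\<^sub>F n in sequentially. \<forall>i\<in>{1..M}. x \<in> Q n i \<longleftrightarrow> x \<in> B i"
  shows "(\<lambda>n. optimal_cost c U M P (Q n)) \<longlonglongrightarrow> optimal_cost c U M P B"
proof -
  interpret prob_space P by fact
  obtain K where K: "\<And>x u. u \<in> U \<Longrightarrow> \<bar>c (x, u)\<bar> \<le> K"
    using bdd unfolding bounded_iff by force
  let ?d = "\<lambda>n. \<Sum>i=1..M. K * (\<integral>x. \<bar>indicator (Q n i) x - indicator (B i) x\<bar> \<partial>P)"
  have below: "bdd_below (expected_cost c M P B' ` policies M U)" for B'
    by (rule bdd_belowI2[of _ 0], rule expected_cost_nonneg[of U], rule nonneg)
  have le: "\<bar>optimal_cost c U M P (Q n) - optimal_cost c U M P B\<bar> \<le> ?d n" for n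
    unfolding optimal_cost_def
    by (rule abs_cINF_diff_le[OF policies_nonempty[OF \<open>U \<noteq> {}\<close>] below below])
      (rule expected_cost_diff_le[OF P sets_P meas K Q B])
  have "(\<lambda>n. \<integral>x. \<bar>indicator (Q n i) x - indicator (B i) x\<bar> \<partial>P) \<longlonglongrightarrow> (\<integral>x. (0::real) \<partial>P)"
    if i: "i \<in> {1..M}" for i
  proof (rule integral_dominated_convergence[where w = "\<lambda>_. 1"])
    have [measurable]: "Q n i \<in> sets P" "B i \<in> sets P" for n
      using Q[of n] B i sets_P by (auto simp: quantizers_def)
    show "(\<lambda>x. \<bar>indicator (Q n i) x - indicator (B i) x\<bar> :: real) \<in> borel_measurable P" for n
      by measurable
    show "AE x in P. (\<lambda>n. \<bar>indicator (Q n i) x - indicator (B i) x\<bar> :: real) \<longlonglongrightarrow> 0"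
      using lim
    proof eventually_elim
      case (elim x)
      then have "\<forall>\<^sub>F n in sequentially. \<bar>indicator (Q n i) x - indicator (B i) x\<bar> = (0::real)"
        by eventually_elim (use i in \<open>auto simp: indicator_def\<close>)
      then show ?case by (rule tendsto_eventually)
    qed
  qed (auto simp: indicator_def)
  then have "?d \<longlonglongrightarrow> (\<Sum>i=1..M. K * (\<integral>x. (0::real) \<partial>P))"
    by (intro tendsto_intros)
  then have "?d \<longlonglongrightarrow> 0" by simp
  then have "(\<lambda>n. optimal_cost c U M P (Q n) - optimal_cost c U M P B) \<longlonglongrightarrow> 0"
    by (rule Lim_null_comparison[rotated]) (use le in auto)
  then show ?thesis by (rule LIM_zero_cancel)
qed

section \<open>Existence of an optimal convex quantizer\<close>

lemma convex_quantizers_nonempty: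
  assumes "M \<ge> 1"
  shows "(convex_quantizers M :: (nat \<Rightarrow> (real ^ 'n) set) set) \<noteq> {}"
proof -
  have "(\<lambda>i. if i = 1 then UNIV else {}) \<in> (convex_quantizers M :: (nat \<Rightarrow> (real ^ 'n) set) set)"
    using assms by (auto simp: convex_quantizers_def quantizers_def disjoint_family_on_def
      split: if_splits)
  then show ?thesis by blast
qed

lemma minimising_sequence_exists:
  fixes f :: "'a \<Rightarrow> real"
  assumes "A \<noteq> {}" "bdd_below (f ` A)"
  obtains a :: "nat \<Rightarrow> 'a" where "\<And>n. a n \<in> A" "(\<lambda>n. f (a n)) \<longlonglongrightarrow> (INF x\<in>A. f x)"
proof -
  have "\<exists>x\<in>A. f x < (INF x\<in>A. f x) + 1 / real (Suc n)" for n
    using cInf_lessD[of "f ` A" "(INF x\<in>A. f x) + 1 / real (Suc n)"] assms by auto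
  then obtain a where a: "\<And>n. a n \<in> A" "\<And>n. f (a n) < (INF x\<in>A. f x) + 1 / real (Suc n)"
    by metis
  have "(\<lambda>n. f (a n)) \<longlonglongrightarrow> (INF x\<in>A. f x)"
  proof (rule real_tendsto_sandwich)
    show "\<forall>\<^sub>F n in sequentially. (INF x\<in>A. f x) \<le> f (a n)"
      using a(1) assms(2) by (intro always_eventually allI cINF_lower)
    show "\<forall>\<^sub>F n in sequentially. f (a n) \<le> (INF x\<in>A. f x) + 1 / real (Suc n)"
      using a(2) less_imp_le by (auto intro!: always_eventually)
    show "(\<lambda>n. (INF x\<in>A. f x) + 1 / real (Suc n)) \<longlonglongrightarrow> (INF x\<in>A. f x)"
      using tendsto_add[OF tendsto_const LIMSEQ_inverse_real_of_nat]
      by (simp add: inverse_eq_divide)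
  qed simp
  then show ?thesis using a that by blast
qed

theorem theorem5p9:
  fixes P :: "(real ^ 'n) measure"
    and U :: "(real ^ 'k) set"
    and c :: "(real ^ 'n) \<times> (real ^ 'k) \<Rightarrow> real"
    and M :: nat
  assumes "M \<ge> 1"
    and "U \<in> sets borel" and "U \<noteq> {}"
    and "prob_space P" and "sets P = sets borel"
    and "absolutely_continuous lborel P"
    and "c \<in> borel_measurable (restrict_space borel (UNIV \<times> U))"
    and "\<And>x u. u \<in> U \<Longrightarrow> 0 \<le> c (x, u)"
    and "bounded (c ` (UNIV \<times> U))"
  shows "\<exists>Qopt\<in>convex_quantizers M.
    optimal_cost c U M P Qopt = (INF Q\<in>convex_quantizers M. optimal_cost c U M P Q)"
proof -
  let ?J = "optimal_cost c U M P"
  have "0 \<le> ?J Q" for Q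
    unfolding optimal_cost_def
    by (rule cINF_greatest[OF policies_nonempty[OF assms(3)]])
      (rule expected_cost_nonneg[of U], rule assms(8))
  then have "bdd_below (?J ` convex_quantizers M)"
    by (intro bdd_belowI2[of _ 0])
  then obtain Q where Q: "\<And>n. Q n \<in> convex_quantizers M"
    and min: "(\<lambda>n. ?J (Q n)) \<longlonglongrightarrow> (INF Q\<in>convex_quantizers M. ?J Q)"
    by (rule minimising_sequence_exists[OF convex_quantizers_nonempty[OF assms(1)]]) blast
  obtain r B where r: "strict_mono (r :: nat \<Rightarrow> nat)" and B: "B \<in> convex_quantizers M"
    and lim: "AE x in lborel. \<forall>\<^sub>F n in sequentially. \<forall>i\<in>{1..M}. x \<in> Q (r n) i \<longleftrightarrow> x \<in> B i"
    by (rule convex_quantizers_subsequence_limit[OF Q])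
  have "AE x in P. \<forall>\<^sub>F n in sequentially. \<forall>i\<in>{1..M}. x \<in> Q (r n) i \<longleftrightarrow> x \<in> B i"
    using absolutely_continuous_AE[OF _ assms(6) lim] assms(5) by simp
  then have "(\<lambda>n. ?J (Q (r n))) \<longlonglongrightarrow> ?J B"
    using Q B
    by (intro optimal_cost_tendsto[OF assms(4,5,3,7,8,9)]) (auto simp: convex_quantizers_def)
  moreover have "(\<lambda>n. ?J (Q (r n))) \<longlonglongrightarrow> (INF Q\<in>convex_quantizers M. ?J Q)"
    using LIMSEQ_subseq_LIMSEQ[OF min r] by (simp add: o_def)
  ultimately have "?J B = (INF Q\<in>convex_quantizers M. ?J Q)"
    by (rule LIMSEQ_unique)
  with B show ?thesis by blast
qed

end
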